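(* Let $A$ be the set of primes $p$ with $p\equiv 2\pmod 3$ for which there exist $\alpha,\beta,\gamma\in\mathbb{N}=\{1,2,\dots\}$ and primes $q,r$ with $\gcd(6,qr)=1$ such that $p+1=2^\alpha3^\beta q$ and $p-1=2^\gamma r$. Let $A_{\le x}=\{p\in A:p\le x\}$ and $\mathfrak{S}_A=9\prod_{p\ge5\text{ prime}}(1-\frac3p)(1-\frac1p)^{-3}$. Assume the Generalized Hardy--Littlewood Conjecture stated in the context. Then $$|A_{\le x}|\sim\frac{\mathfrak{S}_A}{2}\,\frac{x}{(\log x)^3}\qquad(x\to\infty).$$
   Context: $\log$ is the natural logarithm. Singular series: for $R\in\mathbb{N}$ and integers $a_i,b_i$ ($1\le i\le R$) with $\gcd(a_i,b_i)=1$, set $\mathfrak{S}=\prod_{p\text{ prime}}(1-\rho(p)/p)(1-1/p)^{-R}$, where $\rho(p)$ is the number of $n\in\mathbb{Z}/p\mathbb{Z}$ with $\prod_{i=1}^R(a_in+b_i)\equiv 0\pmod p$. Generalized Hardy--Littlewood Conjecture: fix $R\in\mathbb{N}$ and $C>0$; for integers $a_i,b_i$ with $\gcd(a_i,b_i)=1$, $a_i>0$ ($1\le i\le R$) such that the product defining $\mathfrak{S}$ converges, one has $$\#\{n\le x:\ a_in+b_i\text{ is prime for all } i\}=(1+o_{R,C}(1))\,\mathfrak{S}\,\frac{x}{(\log x)^R}+o_{R,C}\Bigl(\frac{x}{(\log x)^R}\Bigr)$$ for all $x$ with $(\log x)^C\ge|a_i|,|b_i|$ for all $i$, where the $o$-terms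 depend only on $R$ and $C$ (uniformly in the $a_i,b_i$). *)

theory Defs
  imports
    "HOL-Analysis.Analysis"
    "HOL-Library.Landau_Symbols"
    "HOL-Number_Theory.Number_Theory"
begin

text \<open>
  Linear forms \<open>a i * n + b i\<close> are indexed by \<open>i \<in> {1..R}\<close>; values of \<open>a\<close>, \<open>b\<close> outside this
  range are irrelevant.  Infinite products over primes are taken in increasing order, with the
  factor \<open>1\<close> at non-primes.  As usual for infinite products, \<^const>\<open>convergent_prod\<close> admits finitely
  many zero factors (\<^const>\<open>prodinf\<close> is then \<open>0\<close>) and requires the partial products of the remaining
  factors to have a nonzero limit.
\<close>

definition rho :: "nat \<Rightarrow> (nat \<Rightarrow> int) \<Rightarrow> (nat \<Rightarrow> int) \<Rightarrow> nat \<Rightarrow> nat" where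
  "rho R a b p = card {n \<in> {0..<int p}. [(\<Prod>i=1..R. a i * n + b i) = 0] (mod int p)}"

definition singular_factor :: "nat \<Rightarrow> (nat \<Rightarrow> int) \<Rightarrow> (nat \<Rightarrow> int) \<Rightarrow> nat \<Rightarrow> real" where
  "singular_factor R a b p =
     (if prime p then (1 - real (rho R a b p) / real p) * (1 - 1 / real p) powi (- int R) else 1)"

definition singular_series :: "nat \<Rightarrow> (nat \<Rightarrow> int) \<Rightarrow> (nat \<Rightarrow> int) \<Rightarrow> real" where
  "singular_series R a b = prodinf (singular_factor R a b)"

definition prime_tuple_count :: "nat \<Rightarrow> (nat \<Rightarrow> int) \<Rightarrow> (nat \<Rightarrow> int) \<Rightarrow> real \<Rightarrow> nat" where
  "prime_tuple_count R a b x =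
     card {n::nat. 1 \<le> n \<and> real n \<le> x \<and> (\<forall>i\<in>{1..R}. prime (a i * int n + b i))}"

text \<open>
  The two error terms \<open>e1\<close>, \<open>e2\<close> may vary with the forms, but both are bounded by a function
  \<open>\<delta>\<close> tending to \<open>0\<close> that is chosen before \<open>a\<close>, \<open>b\<close>, hence depends on \<open>R\<close> and \<open>C\<close> only.
\<close>

definition generalized_hardy_littlewood :: bool where
  "generalized_hardy_littlewood \<longleftrightarrow>
     (\<forall>R::nat. \<forall>C::real. 1 \<le> R \<longrightarrow> 0 < C \<longrightarrow>
       (\<exists>\<delta>::real \<Rightarrow> real. (\<delta> \<longlongrightarrow> 0) at_top \<and>
         (\<forall>(a::nat \<Rightarrow> int) (b::nat \<Rightarrow> int) (x::real).
            (\<forall>i\<in>{1..R}. coprime (a i) (b i) \<and> 0 < a i) \<longrightarrow>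
            convergent_prod (singular_factor R a b) \<longrightarrow>
            1 < x \<longrightarrow>
            (\<forall>i\<in>{1..R}. real_of_int \<bar>a i\<bar> \<le> ln x powr C \<and> real_of_int \<bar>b i\<bar> \<le> ln x powr C) \<longrightarrow>
            (\<exists>e1 e2. \<bar>e1\<bar> \<le> \<delta> x \<and> \<bar>e2\<bar> \<le> \<delta> x \<and>
               real (prime_tuple_count R a b x) =
                 (1 + e1) * singular_series R a b * (x / ln x ^ R) + e2 * (x / ln x ^ R)))))"

definition setA :: "nat set" where
  "setA = {p. prime p \<and> [p = 2] (mod 3) \<and>
     (\<exists>(\<alpha>::nat) (\<beta>::nat) (\<gamma>::nat) (q::nat) (r::nat).
        1 \<le> \<alpha> \<and> 1 \<le> \<beta> \<and> 1 \<le> \<gamma> \<and> prime q \<and> prime r \<and> gcd 6 (q * r) = 1 \<and>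
        p + 1 = 2 ^ \<alpha> * 3 ^ \<beta> * q \<and> p - 1 = 2 ^ \<gamma> * r)}"

definition singular_series_A :: real where
  "singular_series_A =
     9 * prodinf (\<lambda>p::nat. if prime p \<and> 5 \<le> p
                           then (1 - 3 / real p) * (1 - 1 / real p) powi (- 3) else 1)"

end

theory Submission
  imports Defs "HOL-Real_Asymp.Real_Asymp"
begin

text \<open>
  Since \<open>p + 1\<close> and \<open>p - 1\<close> are even and differ by \<open>2\<close>, exactly one of \<open>\<alpha>\<close>, \<open>\<gamma>\<close> equals \<open>1\<close>. So
  \<open>p + 1 = 2 N q\<close> and \<open>p - 1 = 2 M r\<close> where \<open>(M, N)\<close> is either \<open>(1, 2\<^sup>k 3\<^sup>j)\<close> or \<open>(2\<^sup>k, 3\<^sup>j)\<close>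
  with \<open>k, j \<ge> 1\<close>. Fixing a solution of \<open>N q\<^sub>0 = M r\<^sub>0 + 1\<close>, these \<open>p\<close> are the values of
  \<open>2 M N n + (2 M r\<^sub>0 + 1)\<close> for which also \<open>q = M n + q\<^sub>0\<close> and \<open>r = N n + r\<^sub>0\<close> are prime. The relations
  \<open>N q - M r = 1\<close>, \<open>2 N q - p = 1\<close> and \<open>p - 2 M r = 1\<close> make the roots of the three forms distinct modulo
  every prime, so \<open>\<rho> = 1\<close> at \<open>2\<close> and \<open>3\<close>, \<open>\<rho> = 3\<close> elsewhere, and the singular series is always
  \<open>S\<^sub>A\<close>. With \<open>D = 2 M N\<close> the conjecture gives \<open>S\<^sub>A x / (D (log x)\<^sup>3)\<close> for each
  pair, and after normalisation the counts are dominated by a constant times \<open>D\<close> to the power \<open>-1/4\<close>: for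
  \<open>D \<le> (log x / 2)\<^sup>8\<close> by the uniformity of the conjecture, beyond that by the trivial bound \<open>x / D + 1\<close>
  (together with \<open>D \<le> x\<^sup>2\<close> whenever the count is positive).
  Dominated convergence applies, and each of the two families contributes \<open>\<Sum> 1 / D = 1/4\<close>.
\<close>

subsection \<open>The singular series of the linear forms\<close>

text \<open>Indices 1, 2, 3 stand for the forms that produce \<open>q\<close>, \<open>r\<close> and
  \<open>p\<close>. The last branch also takes every index outside \<open>{1..3}\<close>, so that
  coprimality holds without a range condition.\<close>

definition form_coeff :: "nat \<Rightarrow> nat \<Rightarrow> nat \<Rightarrow> int" where
  "form_coeff M N i = int (if i = 1 then M else if i = 2 then N else 2 * M * N)"

definition form_const :: "nat \<Rightarrow> nat \<Rightarrow> nat \<Rightarrow> nat \<Rightarrow> int" where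
  "form_const M q0 r0 i = int (if i = 1 then q0 else if i = 2 then r0 else 2 * M * r0 + 1)"

definition factor_A :: "nat \<Rightarrow> real" where
  "factor_A p = (if prime p \<and> 5 \<le> p then (1 - 3 / real p) * (1 - 1 / real p) powi (- 3) else 1)"

text \<open>The equivalence makes both 2 and 3 divide \<open>M * N\<close>, and coprimality then
  puts each of them into exactly one of \<open>M\<close> and \<open>N\<close>. This is what yields
  \<open>rho = 1\<close> at these two primes.\<close>

definition smooth_pair :: "nat \<Rightarrow> nat \<Rightarrow> bool" where
  "smooth_pair M N \<longleftrightarrow> coprime M N \<and> (\<forall>l. prime l \<longrightarrow> l dvd M * N \<longleftrightarrow> l = 2 \<or> l = 3)"

text \<open>If \<open>l\<close> divides \<open>a\<close>, coprimality keeps it from dividing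
  \<open>b\<close>. Otherwise \<open>a\<close> is invertible modulo \<open>l\<close>, and the only
  root is \<open>- b\<close> times its inverse.\<close>

lemma card_linear_roots:
  fixes a b :: int and l :: nat
  assumes "coprime a b" "prime l"
  shows "card {n \<in> {0..<int l}. int l dvd a * n + b} = (if int l dvd a then 0 else 1)"
proof (cases "int l dvd a")
  case True
  have "\<not> is_unit (int l)" using assms by auto
  then have "\<not> int l dvd b"
    using True assms coprime_common_divisor by blast
  then have "{n \<in> {0..<int l}. int l dvd a * n + b} = {}"
    using True by (auto simp: dvd_add_right_iff)
  then show ?thesis by (simp only: True card.empty if_True)
next
  case False
  have pl: "prime (int l)" using assms by simp
  then have "coprime a (int l)"
    using False by (metis coprime_commute prime_imp_coprime)
  then obtain y where y: "[a * y = 1] (mod int l)"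
    using cong_solve_coprime_int by blast
  define z where "z = (- b * y) mod int l"
  have lpos: "int l > 0" using assms prime_gt_0_nat by simp
  have "int l dvd a * n + b \<longleftrightarrow> n = z" if n: "n \<in> {0..<int l}" for n
  proof -
    have z1: "int l dvd a * z + b"
    proof -
      have "[a * z + b = a * (- b * y) + b] (mod int l)"
        unfolding z_def by (intro cong_add cong_mult cong_refl) (simp add: cong_def)
      also have "a * (- b * y) + b = - b * (a * y) + b" by (simp add: algebra_simps)
      also have "[- b * (a * y) + b = - b * 1 + b] (mod int l)"
        using y by (intro cong_add cong_mult cong_refl)
      finally show ?thesis by (simp add: cong_0_iff)
    qed
    have zr: "0 \<le> z" "z < int l" unfolding z_def using lpos by auto
    show ?thesis
    proof
      assume "int l dvd a * n + b"
      with z1 have "int l dvd a * (n - z)"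
        by (metis add_diff_cancel_right dvd_diff right_diff_distrib)
      then have "int l dvd n - z"
        using False pl prime_dvd_mult_iff by blast
      then have "[n = z] (mod int l)" by (simp add: cong_iff_dvd_diff)
      then show "n = z" using n zr by (simp add: cong_def)
    qed (use z1 in simp)
  qed
  moreover have "z \<in> {0..<int l}" unfolding z_def using lpos by auto
  ultimately have "{n \<in> {0..<int l}. int l dvd a * n + b} = {z}" by auto
  then show ?thesis using False by simp
qed

lemma prod_forms:
  "(\<Prod>i=1..3. form_coeff M N i * n + form_const M q0 r0 i) =
     (int M * n + int q0) * (int N * n + int r0) * (2 * int M * int N * n + (2 * int M * int r0 + 1))"
  by (simp add: form_coeff_def form_const_def numeral_3_eq_3 algebra_simps)

text \<open>In each case a common divisor divides an integer combination with value 1, such as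
  \<open>N * q0 - M * r0\<close>.\<close>

lemma coprime_forms:
  assumes "N * q0 = M * r0 + 1"
  shows "coprime (form_coeff M N i) (form_const M q0 r0 i)"
proof -
  have e: "int N * int q0 = int M * int r0 + 1"
    using assms by (metis of_nat_1 of_nat_add of_nat_mult)
  have 1: "coprime (int M) (int q0)"
  proof (rule coprimeI)
    fix c assume "c dvd int M" "c dvd int q0"
    then have "c dvd int N * int q0 - int M * int r0" by (simp add: dvd_diff)
    then show "is_unit c" using e by simp
  qed
  have 2: "coprime (int N) (int r0)"
  proof (rule coprimeI)
    fix c assume "c dvd int N" "c dvd int r0"
    then have "c dvd int N * int q0 - int M * int r0" by (simp add: dvd_diff)
    then show "is_unit c" using e by simp
  qed
  have 3: "coprime (2 * int M) (2 * int M * int r0 + 1)"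
  proof (rule coprimeI)
    fix c assume "c dvd 2 * int M" "c dvd 2 * int M * int r0 + 1"
    then show "is_unit c" using dvd_add_right_iff dvd_mult2 by blast
  qed
  have 4: "coprime (int N) (2 * int M * int r0 + 1)"
  proof (rule coprimeI)
    fix c assume c: "c dvd int N" "c dvd 2 * int M * int r0 + 1"
    then have "c dvd 2 * (int N * int q0) - (2 * int M * int r0 + 1)" by (simp add: dvd_diff)
    then show "is_unit c" by (simp add: e)
  qed
  have 5: "coprime (int (2 * M * N)) (int (2 * M * r0 + 1))"
    using 3 4 by (simp only: coprime_mult_left_iff of_nat_mult of_nat_add of_nat_numeral of_nat_1)
  consider "i = 1" | "i = 2" | "i \<noteq> 1" "i \<noteq> 2" by blast
  then show ?thesis
    by cases (use 1 2 5 in \<open>simp_all only: form_coeff_def form_const_def if_True if_False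
      simp_thms one_eq_numeral_iff numeral_eq_one_iff num.distinct\<close>)
qed

text \<open>A common root of two forms would make \<open>l\<close> divide 1, by \<open>qr\<close>,
  \<open>qp\<close> or \<open>rp\<close>. So the three root sets are disjoint and their sizes, each
  0 or 1, add up.\<close>

lemma rho_forms:
  assumes e: "N * q0 = M * r0 + 1" and l: "prime l"
  shows "rho 3 (form_coeff M N) (form_const M q0 r0) l =
    (if l dvd M then 0 else 1) + (if l dvd N then 0 else 1) + (if l dvd 2 * M * N then 0 else 1)"
proof -
  define R where "R a b = {n \<in> {0..<int l}. int l dvd a * n + b}" for a b
  have ei: "int N * int q0 = int M * int r0 + 1"
    using assms by (metis of_nat_1 of_nat_add of_nat_mult)
  have pl: "prime (int l)" using l by simp
  have nu: "\<not> int l dvd 1" using pl not_prime_unit by blast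
  let ?q = "\<lambda>n. int M * n + int q0" and ?r = "\<lambda>n. int N * n + int r0"
    and ?p = "\<lambda>n. 2 * int M * int N * n + (2 * int M * int r0 + 1)"
  have qr: "int N * ?q n - int M * ?r n = 1" for n using ei by (simp add: algebra_simps)
  have qp: "2 * int N * ?q n - ?p n = 1" for n using ei by (simp add: algebra_simps)
  have rp: "?p n - 2 * int M * ?r n = 1" for n by (simp add: algebra_simps)
  have d: "\<not> (int l dvd ?q n \<and> int l dvd ?r n)" "\<not> (int l dvd ?q n \<and> int l dvd ?p n)"
      "\<not> (int l dvd ?r n \<and> int l dvd ?p n)" for n
    using nu qr[of n] qp[of n] rp[of n] by (metis dvd_diff dvd_mult)+
  have "{n \<in> {0..<int l}. [(\<Prod>i=1..3. form_coeff M N i * n + form_const M q0 r0 i) = 0] (mod int l)}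
     = R (int M) (int q0) \<union> R (int N) (int r0) \<union> R (2 * int M * int N) (2 * int M * int r0 + 1)"
    using pl unfolding prod_forms R_def cong_0_iff by (auto simp: prime_dvd_mult_iff)
  then have "rho 3 (form_coeff M N) (form_const M q0 r0) l
     = card (R (int M) (int q0) \<union> R (int N) (int r0) \<union> R (2 * int M * int N) (2 * int M * int r0 + 1))"
    unfolding rho_def by simp
  also have "\<dots> = card (R (int M) (int q0)) + card (R (int N) (int r0))
      + card (R (2 * int M * int N) (2 * int M * int r0 + 1))"
  proof -
    have fin: "finite (R a b)" for a b unfolding R_def by (rule finite_subset[of _ "{0..<int l}"]) auto
    have "R (int M) (int q0) \<inter> R (int N) (int r0) = {}"
      and "(R (int M) (int q0) \<union> R (int N) (int r0))
             \<inter> R (2 * int M * int N) (2 * int M * int r0 + 1) = {}"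
      using d unfolding R_def by blast+
    then show ?thesis by (simp add: card_Un_disjoint fin)
  qed
  also have "card (R (int M) (int q0)) = (if l dvd M then 0 else 1)"
    using card_linear_roots[OF _ l] coprime_forms[OF e, of 1] unfolding R_def
    by (simp add: form_coeff_def form_const_def)
  also have "card (R (int N) (int r0)) = (if l dvd N then 0 else 1)"
    using card_linear_roots[OF _ l] coprime_forms[OF e, of 2] unfolding R_def
    by (simp add: form_coeff_def form_const_def)
  also have "card (R (2 * int M * int N) (2 * int M * int r0 + 1)) = (if l dvd 2 * M * N then 0 else 1)"
  proof -
    have "coprime (2 * int M * int N) (2 * int M * int r0 + 1)"
      using coprime_forms[OF e, of 3] by (simp add: form_coeff_def form_const_def add.commute)
    moreover have "int l dvd 2 * int M * int N \<longleftrightarrow> l dvd 2 * M * N"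
      by (metis int_dvd_int_iff of_nat_mult of_nat_numeral)
    ultimately show ?thesis using card_linear_roots[OF _ l] unfolding R_def by auto
  qed
  finally show ?thesis .
qed

section \<open>Convergence and positivity of the Euler product\<close>

lemma factor_A_bound:
  assumes "5 \<le> p"
  shows "\<bar>factor_A p - 1\<bar> \<le> 6 / real p ^ 2"
proof (cases "prime p")
  case True
  define x where "x = real p"
  have x: "x \<ge> 5" using assms unfolding x_def by simp
  have "factor_A p = (1 - 3 / x) / (1 - 1 / x) ^ 3"
    using True assms by (simp add: factor_A_def x_def power_int_minus divide_inverse)
  also have "\<dots> = (1 - 3 / x) * x ^ 3 / (x - 1) ^ 3"
  proof -
    have "1 - 1 / x = (x - 1) / x" using x by (simp add: field_simps)
    then show ?thesis by (simp add: power_divide)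
  qed
  \<comment> \<open>The cubic and quadratic terms cancel against \<open>(x - 1) ^ 3\<close>; the
    linear remainder makes the distance from 1 of order \<open>1 / x ^ 2\<close>.\<close>
  also have "(1 - 3 / x) * x ^ 3 = (x - 1) ^ 3 - (3 * x - 1)"
    using x by (simp add: field_simps power3_eq_cube)
  also have "\<dots> / (x - 1) ^ 3 - 1 = - (3 * x - 1) / (x - 1) ^ 3"
    using x by (simp add: diff_divide_distrib)
  finally have eq: "\<bar>factor_A p - 1\<bar> = (3 * x - 1) / (x - 1) ^ 3" using x by simp
  have "(3 * x - 1) * x ^ 2 \<le> 6 * (x - 1) ^ 3"
  proof -
    \<comment> \<open>The shift turns the difference of the two sides into a polynomial in
      \<open>y\<close> with nonnegative coefficients.\<close>
    define y where "y = x - 5"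
    have "x = y + 5" "y \<ge> 0" using x y_def by auto
    then have "6 * (x - 1) ^ 3 - (3 * x - 1) * x ^ 2 = 3 * y^3 + 28 * y^2 + 73 * y + 34"
      by (simp add: algebra_simps power2_eq_square power3_eq_cube)
    moreover have "3 * y^3 + 28 * y^2 + 73 * y + 34 \<ge> 0" using \<open>y \<ge> 0\<close> by simp
    ultimately show ?thesis by linarith
  qed
  then show ?thesis unfolding eq x_def[symmetric] using x by (simp add: field_simps)
qed (simp add: factor_A_def)

lemma factor_A_pos: "factor_A p > 0"
proof -
  have "(1 - 3 / real p) * (1 - 1 / real p) powi (- 3) > 0" if "5 \<le> p"
    using that by (intro mult_pos_pos zero_less_power_int) (auto simp: field_simps)
  then show ?thesis by (simp add: factor_A_def)
qed

lemma convergent_prod_factor_A: "convergent_prod factor_A"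
proof -
  have "summable (\<lambda>p. norm (factor_A p - 1))"
  proof (rule summable_comparison_test_ev)
    show "eventually (\<lambda>p. norm (norm (factor_A p - 1)) \<le> 6 * (1 / real p ^ 2)) sequentially"
      using eventually_ge_at_top[of 5] by eventually_elim (use factor_A_bound in auto)
    show "summable (\<lambda>p. 6 * (1 / real p ^ 2))"
      using inverse_power_summable[of 2, where ?'a = real]
      by (intro summable_mult) (simp add: inverse_eq_divide)
  qed
  then show ?thesis
    using summable_imp_abs_convergent_prod abs_convergent_prod_imp_convergent_prod by blast
qed

lemma singular_series_A_eq: "singular_series_A = 9 * prodinf factor_A"
  unfolding singular_series_A_def factor_A_def ..

lemma singular_series_A_pos: "singular_series_A > 0"
  using less_0_prodinf[OF convergent_prod_factor_A factor_A_pos] by (simp add: singular_series_A_eq)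

context
  fixes M N q0 r0 :: nat
  assumes MN: "smooth_pair M N" and qr0: "N * q0 = M * r0 + 1"
begin

text \<open>At 2 and 3, where \<open>factor_A\<close> is 1, \<open>rho = 1\<close> leaves
  \<open>(1 - 1 / l)\<close> to the power -2, that is 4 and \<open>9 / 4\<close>. Their product is
  the 9 in \<open>singular_series_A\<close>.\<close>

lemma singular_factor_forms:
  "singular_factor 3 (form_coeff M N) (form_const M q0 r0) l =
     factor_A l * (if l = 2 then 4 else if l = 3 then 9 / 4 else 1)"
proof (cases "prime l")
  case True
  have nb: "\<not> (l dvd M \<and> l dvd N)"
    using MN True coprime_common_divisor[of M N l] by (auto simp: smooth_pair_def)
  have dvd: "l dvd M \<or> l dvd N \<longleftrightarrow> l = 2 \<or> l = 3"
    using MN True by (simp add: smooth_pair_def prime_dvd_mult_iff)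
  have l2: "l dvd 2 * M * N \<longleftrightarrow> l = 2 \<or> l = 3"
    using True dvd by (auto simp: prime_dvd_mult_iff dest: primes_dvd_imp_eq[OF _ two_is_prime_nat])
  consider "l = 2 \<or> l = 3" | "l \<ge> 5"
  proof -
    have "l \<noteq> 4" using True primes_dvd_imp_eq[of 2 4] by auto
    then show ?thesis using prime_ge_2_nat[OF True] that by linarith
  qed
  then show ?thesis
  proof cases
    case 1
    then have "rho 3 (form_coeff M N) (form_const M q0 r0) l = 1"
      using nb dvd l2 by (auto simp: rho_forms[OF qr0 True])
    with 1 show ?thesis using True
      by (auto simp: singular_factor_def factor_A_def power_int_minus power3_eq_cube)
  next
    case 2
    then have "rho 3 (form_coeff M N) (form_const M q0 r0) l = 3"
      using dvd l2 by (auto simp: rho_forms[OF qr0 True])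
    with 2 show ?thesis using True
      by (auto simp: singular_factor_def factor_A_def)
  qed
qed (auto simp: singular_factor_def factor_A_def)

lemma
  shows convergent_prod_forms:
      "convergent_prod (singular_factor 3 (form_coeff M N) (form_const M q0 r0))"
    and singular_series_forms:
      "singular_series 3 (form_coeff M N) (form_const M q0 r0) = singular_series_A"
proof -
  let ?c = "\<lambda>l::nat. if l = 2 then 4 else if l = 3 then 9 / 4 else 1::real"
  have c: "?c has_prod (\<Prod>l\<in>{2,3}. ?c l)"
    by (rule has_prod_finite) auto
  have "factor_A has_prod prodinf factor_A"
    using convergent_prod_factor_A by (rule convergent_prod_has_prod)
  from has_prod_mult[OF this c]
  have hp: "singular_factor 3 (form_coeff M N) (form_const M q0 r0) has_prod singular_series_A"
    by (simp add: singular_factor_forms[abs_def] singular_series_A_eq mult.commute)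
  then show "convergent_prod (singular_factor 3 (form_coeff M N) (form_const M q0 r0))"
    by (auto simp: convergent_prod_def has_prod_def)
  show "singular_series 3 (form_coeff M N) (form_const M q0 r0) = singular_series_A"
    unfolding singular_series_def using has_prod_unique[OF hp] by simp
qed

end

subsection \<open>Primes in a fixed class\<close>

text \<open>\<open>M\<close> and \<open>N\<close> are half the cofactors of \<open>r\<close> in
  \<open>p - 1\<close> and of \<open>q\<close> in \<open>p + 1\<close>. Writing \<open>p\<close> as
  \<open>2 * M * r + 1\<close> avoids truncated subtraction.\<close>

definition linked_primes :: "nat \<Rightarrow> nat \<Rightarrow> nat set" where
  "linked_primes M N = {p. prime p \<and> (\<exists>q r. prime q \<and> prime r \<and> coprime 6 (q * r) \<and>
     p + 1 = 2 * N * q \<and> p = 2 * M * r + 1)}"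

definition linked_count :: "nat \<Rightarrow> nat \<Rightarrow> real \<Rightarrow> nat" where
  "linked_count M N x = card {p \<in> linked_primes M N. real p \<le> x}"

lemma finite_nat_le_real: "finite {n::nat. P n \<and> real n \<le> x}"
  by (rule finite_subset[of _ "{..nat \<lfloor>x\<rfloor>}"]) (auto simp: le_nat_floor)

lemma coprime_6_prime:
  assumes "prime (q::nat)" "q \<noteq> 2" "q \<noteq> 3"
  shows "coprime 6 q"
proof -
  have "coprime 2 q" "coprime 3 q"
    using assms by (intro primes_coprime; simp)+
  then have "coprime (2 * 3) q" by (simp only: coprime_mult_left_iff)
  then show ?thesis by simp
qed

lemma coprime_6_prime_ge_5:
  assumes "coprime (6::nat) q" "prime q"
  shows "q \<ge> 5"
proof -
  have "coprime (2 * 3) q" using assms by simp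
  then have "coprime 2 q" "coprime 3 q" by (simp_all only: coprime_mult_left_iff)
  then have "q \<noteq> 2" "q \<noteq> 3" "q \<noteq> 4" by auto
  then show ?thesis using prime_ge_2_nat[OF assms(2)] by linarith
qed

text \<open>The bound on \<open>q0\<close> is what later keeps all constant terms at most
  \<open>2 * M * N\<close> and the shift of the progression below one period.\<close>

lemma ex_coprime_solution:
  fixes M N :: nat
  assumes "coprime M N" "M > 0" "N > 0"
  obtains q0 r0 where "N * q0 = M * r0 + 1" "q0 \<le> M"
proof -
  obtain y where y: "[N * y = Suc 0] (mod M)"
    using cong_solve_coprime_nat[of N M] assms by (auto simp: coprime_commute)
  \<comment> \<open>The representative is taken from 1 to \<open>M\<close> instead of 0 to
    \<open>M - 1\<close>: positivity of \<open>q\<close> makes \<open>N * q - 1\<close>, and hence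
    \<open>r\<close>, a natural number.\<close>
  define q where "q = (if y mod M = 0 then M else y mod M)"
  have q: "[q = y] (mod M)" "q > 0" "q \<le> M"
    using assms by (auto simp: q_def cong_def less_imp_le)
  have "[N * q = 1] (mod M)"
    using y cong_scalar_left[OF q(1), of N] by (auto intro: cong_trans)
  moreover have "N * q \<ge> 1" using q(2) assms by (simp add: Suc_leI)
  ultimately obtain r where "N * q = M * r + 1"
    by (metis cong_le_nat cong_sym mult.commute add.commute)
  then show ?thesis using that q by blast
qed

section \<open>Linked primes as prime values of three linear forms\<close>

context
  fixes M N q0 r0 :: nat
  assumes cop: "coprime M N" and pos: "M > 0" "N > 0"
    and qr0: "N * q0 = M * r0 + 1" and q0: "q0 \<le> M"
begin

text \<open>The solutions of \<open>N * q = M * r + 1\<close> form one arithmetic progression,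
  because \<open>N\<close> is invertible modulo \<open>M\<close>.\<close>

lemma linked_primesE:
  assumes "p \<in> linked_primes M N"
  obtains n where "p = 2 * M * N * n + (2 * M * r0 + 1)"
    "prime (M * n + q0)" "prime (N * n + r0)"
proof -
  obtain q r where qr: "prime q" "prime r" "p + 1 = 2 * N * q" "p = 2 * M * r + 1"
    using assms unfolding linked_primes_def by blast
  then have e: "N * q = M * r + 1" by simp
  have "[N * q = N * q0] (mod M)" unfolding e qr0 cong_def
    by (metis mod_mult_self4)
  then have c: "[q = q0] (mod M)"
    using cong_mult_lcancel_nat cop coprime_commute by blast
  \<comment> \<open>Since \<open>q0 \<le> M\<close>, no smaller positive number is congruent to
    \<open>q0\<close> modulo \<open>M\<close>. Hence the parameter \<open>n\<close> is a natural
    number.\<close>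
  have "q0 \<le> q"
  proof (rule ccontr)
    assume "\<not> q0 \<le> q"
    then have "M dvd q0 - q" using c by (metis cong_altdef_nat cong_sym nat_le_linear)
    moreover have "0 < q0 - q" "q0 - q < M"
      using \<open>\<not> q0 \<le> q\<close> q0 prime_gt_0_nat[OF qr(1)] by auto
    ultimately show False using nat_dvd_not_less by blast
  qed
  then have "M dvd q - q0" using c by (metis cong_altdef_nat)
  then obtain n where "q - q0 = M * n" by blast
  then have n: "q = M * n + q0" using \<open>q0 \<le> q\<close> by simp
  have "M * r + 1 = M * (N * n + r0) + 1"
    using e qr0 unfolding n by (simp add: algebra_simps)
  then have "r = N * n + r0" using pos by simp
  moreover have "p = 2 * M * N * n + (2 * M * r0 + 1)"
    using qr(4) \<open>r = N * n + r0\<close> by (simp add: algebra_simps)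
  ultimately show ?thesis using n qr that by blast
qed

text \<open>Excluding 2 and 3 supplies the coprimality to 6. \<open>prime_tuple_count\<close> does
  not exclude these values, so comparing the counts needs a correction.\<close>

lemma linked_primesI:
  assumes "prime (2 * M * N * n + (2 * M * r0 + 1))" "prime (M * n + q0)" "prime (N * n + r0)"
    "M * n + q0 \<notin> {2, 3}" "N * n + r0 \<notin> {2, 3}"
  shows "2 * M * N * n + (2 * M * r0 + 1) \<in> linked_primes M N"
proof -
  have "2 * M * N * n + (2 * M * r0 + 1) + 1 = 2 * N * (M * n + q0)"
    using qr0 by (simp add: algebra_simps)
  moreover have "2 * M * N * n + (2 * M * r0 + 1) = 2 * M * (N * n + r0) + 1"
    by (simp add: algebra_simps)
  moreover have "coprime 6 ((M * n + q0) * (N * n + r0))"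
    using coprime_6_prime assms by simp
  ultimately show ?thesis using assms unfolding linked_primes_def by blast
qed

lemma prime_tuple_count_forms:
  "prime_tuple_count 3 (form_coeff M N) (form_const M q0 r0) y =
   card {n. 1 \<le> n \<and> real n \<le> y \<and> prime (M * n + q0) \<and> prime (N * n + r0) \<and>
     prime (2 * M * N * n + (2 * M * r0 + 1))}"
proof -
  have "(\<forall>i\<in>{1..3}. prime (form_coeff M N i * int n + form_const M q0 r0 i)) \<longleftrightarrow>
     prime (M * n + q0) \<and> prime (N * n + r0) \<and> prime (2 * M * N * n + (2 * M * r0 + 1))" for n
  proof -
    have "{1..3} = {1, 2, 3::nat}" by auto
    then show ?thesis
      by (simp add: form_coeff_def form_const_def del: prime_int_nat_transfer of_nat_Suc of_nat_add of_nat_mult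
          flip: prime_int_nat_transfer of_nat_add of_nat_mult)
  qed
  then show ?thesis unfolding prime_tuple_count_def by simp
qed

text \<open>Dropping the constant term from \<open>p \<le> x\<close> gives
  \<open>n \<le> x / (2 M N)\<close>; of these \<open>n\<close> the tuple count omits only
  0.\<close>

lemma linked_count_le_prime_tuple_count:
  "linked_count M N x \<le>
     prime_tuple_count 3 (form_coeff M N) (form_const M q0 r0) (x / real (2 * M * N)) + 1"
proof -
  define f where "f n = 2 * M * N * n + (2 * M * r0 + 1)" for n
  define T where "T = {n. 1 \<le> n \<and> real n \<le> x / real (2 * M * N) \<and> prime (M * n + q0) \<and>
    prime (N * n + r0) \<and> prime (f n)}"
  have finT: "finite T"
    by (rule finite_subset[OF _ finite_nat_le_real[of "\<lambda>_. True" "x / real (2 * M * N)"]]) (auto simp: T_def)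
  have "{p \<in> linked_primes M N. real p \<le> x} \<subseteq> f ` insert 0 T"
  proof
    fix p assume p: "p \<in> {p \<in> linked_primes M N. real p \<le> x}"
    then obtain n where n: "p = f n" "prime (M * n + q0)" "prime (N * n + r0)"
      unfolding f_def by (metis (lifting) linked_primesE mem_Collect_eq)
    have "prime (f n)" using p n by (simp add: linked_primes_def)
    have "2 * M * N * n \<le> p" using n(1) by (simp add: f_def)
    then have "real (2 * M * N * n) \<le> x" using p by (metis (lifting) mem_Collect_eq of_nat_mono order_trans)
    then have "real n \<le> x / real (2 * M * N)" using pos by (simp add: field_simps)
    with n \<open>prime (f n)\<close> have "n \<in> insert 0 T" by (auto simp: T_def)
    with n(1) show "p \<in> f ` insert 0 T" by blast
  qed
  then have "linked_count M N x \<le> card (f ` insert 0 T)"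
    unfolding linked_count_def using finT by (intro card_mono) auto
  also have "\<dots> \<le> card (insert 0 T)" using finT by (intro card_image_le) auto
  also have "\<dots> \<le> card T + 1" using finT by (simp add: card_insert_if)
  finally show ?thesis unfolding prime_tuple_count_forms T_def f_def .
qed

text \<open>
  The \<open>5\<close> counts the \<open>n\<close> with \<open>q\<close> or \<open>r\<close> in \<open>{2, 3}\<close> (at most two each) and the at most one
  \<open>n \<le> x / (2 M N)\<close> with \<open>p > x\<close>; the \<open>1\<close> in the converse bound above is \<open>n = 0\<close>.
\<close>
lemma prime_tuple_count_le_linked_count:
  "prime_tuple_count 3 (form_coeff M N) (form_const M q0 r0) (x / real (2 * M * N))
     \<le> linked_count M N x + 5"
proof -
  define f where "f n = 2 * M * N * n + (2 * M * r0 + 1)" for n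
  define T where "T = {n. 1 \<le> n \<and> real n \<le> x / real (2 * M * N) \<and> prime (M * n + q0) \<and>
    prime (N * n + r0) \<and> prime (f n)}"
  have injf: "inj f" using pos by (intro injI) (simp add: f_def)
  define A where "A = {n. f n \<in> linked_primes M N \<and> real (f n) \<le> x}"
  define B where "B = {n. M * n + q0 \<in> {2, 3}}"
  define C where "C = {n. N * n + r0 \<in> {2, 3}}"
  define E where "E = {nat \<lfloor>x / real (2 * M * N)\<rfloor>}"
  have finL: "finite {p \<in> linked_primes M N. real p \<le> x}"
    by (rule finite_subset[OF _ finite_nat_le_real[of "\<lambda>_. True" x]]) auto
  have A: "finite A" "card A \<le> linked_count M N x"
  proof -
    have "f ` A \<subseteq> {p \<in> linked_primes M N. real p \<le> x}" by (auto simp: A_def)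
    moreover have "inj_on f A" using injf by (rule inj_on_subset) simp
    ultimately show "finite A" "card A \<le> linked_count M N x"
      unfolding linked_count_def using finL by (auto intro: inj_on_finite card_inj_on_le)
  qed
  have c2: "card {2, 3::nat} = 2" by simp
  have B: "finite B" "card B \<le> 2"
  proof -
    have i: "inj_on (\<lambda>n. M * n + q0) B" "(\<lambda>n. M * n + q0) ` B \<subseteq> {2, 3}"
      using pos by (auto simp: inj_on_def B_def)
    show "finite B" using inj_on_finite[OF i] by simp
    show "card B \<le> 2" using card_inj_on_le[OF i] c2 by simp
  qed
  have C: "finite C" "card C \<le> 2"
  proof -
    have i: "inj_on (\<lambda>n. N * n + r0) C" "(\<lambda>n. N * n + r0) ` C \<subseteq> {2, 3}"
      using pos by (auto simp: inj_on_def C_def)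
    show "finite C" using inj_on_finite[OF i] by simp
    show "card C \<le> 2" using card_inj_on_le[OF i] c2 by simp
  qed
  have "T \<subseteq> A \<union> B \<union> C \<union> E"
  proof
    fix n assume n: "n \<in> T"
    show "n \<in> A \<union> B \<union> C \<union> E"
    proof (cases "real (f n) \<le> x")
      case True
      then show ?thesis using n linked_primesI[of n]
        by (auto simp: T_def A_def B_def C_def f_def)
    next
      case False
      \<comment> \<open>From \<open>q0 \<le> M\<close> the value \<open>f n\<close> stays within the
        next period, so \<open>f n > x\<close> forces \<open>n\<close> to be the floor of
        \<open>x / (2 M N)\<close>.\<close>
      have "f n + 1 = 2 * M * N * n + 2 * (N * q0)" unfolding f_def qr0 by (simp add: algebra_simps)
      also have "\<dots> \<le> 2 * M * N * n + 2 * (N * M)" using q0 by (intro add_mono mult_mono) auto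
      finally have "f n \<le> 2 * M * N * (n + 1)" by (simp add: algebra_simps)
      with False have "x < real (2 * M * N * (n + 1))"
        by (meson less_le_trans not_le of_nat_mono)
      then have "x / real (2 * M * N) < real n + 1" using pos by (simp add: field_simps)
      moreover have "real n \<le> x / real (2 * M * N)" using n by (simp add: T_def)
      ultimately have "\<lfloor>x / real (2 * M * N)\<rfloor> = int n" by (simp add: floor_eq_iff)
      then show ?thesis by (simp add: E_def)
    qed
  qed
  then have "card T \<le> card (A \<union> B \<union> C \<union> E)"
    using A B C by (intro card_mono) (auto simp: E_def)
  also have "\<dots> \<le> card A + card B + card C + card E"
    using card_Un_le[of "A \<union> B \<union> C" E] card_Un_le[of "A \<union> B" C] card_Un_le[of A B] by linarith
  also have "\<dots> \<le> linked_count M N x + 5" using A B C by (simp add: E_def)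
  finally show ?thesis unfolding prime_tuple_count_forms T_def f_def .
qed

end

section \<open>Bounds that hold without the conjecture\<close>

lemma prime_tuple_count_le:
  assumes "y \<ge> 0"
  shows "real (prime_tuple_count R a b y) \<le> y"
proof -
  have "prime_tuple_count R a b y \<le> card {1..nat \<lfloor>y\<rfloor>}"
    unfolding prime_tuple_count_def by (intro card_mono) (auto simp: le_nat_floor)
  then show ?thesis using assms by (simp add: le_nat_iff) linarith
qed

lemma linked_count_trivial:
  assumes "coprime M N" "M > 0" "N > 0" "x \<ge> 0"
  shows "real (linked_count M N x) \<le> x / real (2 * M * N) + 1"
proof -
  obtain q0 r0 where *: "N * q0 = M * r0 + 1" "q0 \<le> M"
    using ex_coprime_solution assms by metis
  have "real (linked_count M N x) \<le>
     real (prime_tuple_count 3 (form_coeff M N) (form_const M q0 r0) (x / real (2 * M * N))) + 1"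
    using linked_count_le_prime_tuple_count[OF assms(1-3) *, of x] by linarith
  with prime_tuple_count_le[of "x / real (2 * M * N)" 3 "form_coeff M N" "form_const M q0 r0"] assms
  show ?thesis by simp
qed

text \<open>Both \<open>2 * N\<close> and \<open>M\<close> are at most \<open>p\<close>. This leaves
  finitely many nonempty classes for each \<open>x\<close> and turns errors constant in
  \<open>D\<close> into negative powers of \<open>D\<close>.\<close>

lemma linked_count_pos:
  assumes "linked_count M N x > 0"
  shows "real (2 * M * N) \<le> x ^ 2"
proof -
  obtain p where p: "p \<in> linked_primes M N" "real p \<le> x"
    using assms unfolding linked_count_def by (auto simp: card_gt_0_iff)
  then obtain q r where qr: "prime q" "prime r" "coprime 6 q" "p + 1 = 2 * N * q" "p = 2 * M * r + 1"
    unfolding linked_primes_def by auto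
  have q5: "q \<ge> 5" using coprime_6_prime_ge_5 qr by blast
  have "N * 5 \<le> N * q" "M * 1 \<le> M * r"
    using q5 prime_gt_0_nat[OF qr(2)] by (intro mult_le_mono, simp_all)+
  moreover have "N > 0" using qr(4) by (cases N) auto
  ultimately have "2 * N \<le> p" "M \<le> p" using qr by linarith+
  then have "2 * N * M \<le> p * p" by (rule mult_le_mono)
  then have "real (2 * M * N) \<le> real p ^ 2"
    by (metis mult.assoc mult.commute of_nat_mono of_nat_power power2_eq_square)
  also have "\<dots> \<le> x ^ 2" using p by (intro power_mono) auto
  finally show ?thesis .
qed

section \<open>Asymptotics and uniform bounds from the conjecture\<close>

lemma generalized_hardy_littlewood_linked_count:
  assumes generalized_hardy_littlewood
  obtains \<delta> :: "real \<Rightarrow> real" where "(\<delta> \<longlongrightarrow> 0) at_top"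
    "\<And>M N x. smooth_pair M N \<Longrightarrow> M > 0 \<Longrightarrow> N > 0 \<Longrightarrow> 1 < x / real (2 * M * N) \<Longrightarrow>
       real (2 * M * N) \<le> ln (x / real (2 * M * N)) ^ 8 \<Longrightarrow>
       \<bar>real (linked_count M N x) - singular_series_A *
           ((x / real (2 * M * N)) / ln (x / real (2 * M * N)) ^ 3)\<bar>
         \<le> \<delta> (x / real (2 * M * N)) * (singular_series_A + 1) *
             ((x / real (2 * M * N)) / ln (x / real (2 * M * N)) ^ 3) + 5"
proof -
  \<comment> \<open>The choice is \<open>R = 3\<close> and \<open>C = 8\<close>. An exponent above 3
    is wanted so that \<open>ln x ^ 3 / D\<close> is at most a constant times a negative power of
    \<open>D\<close> where the conjecture no longer reaches.\<close>
  from assms obtain \<delta> :: "real \<Rightarrow> real" where \<delta>: "(\<delta> \<longlongrightarrow> 0) at_top"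
    and hl: "\<And>a b x. (\<forall>i\<in>{1..3}. coprime (a i) (b i) \<and> 0 < a i) \<Longrightarrow>
            convergent_prod (singular_factor 3 a b) \<Longrightarrow> 1 < x \<Longrightarrow>
            (\<forall>i\<in>{1..3}. real_of_int \<bar>a i\<bar> \<le> ln x powr 8 \<and> real_of_int \<bar>b i\<bar> \<le> ln x powr 8) \<Longrightarrow>
            (\<exists>e1 e2. \<bar>e1\<bar> \<le> \<delta> x \<and> \<bar>e2\<bar> \<le> \<delta> x \<and>
               real (prime_tuple_count 3 a b x) =
                 (1 + e1) * singular_series 3 a b * (x / ln x ^ 3) + e2 * (x / ln x ^ 3))"
    unfolding generalized_hardy_littlewood_def
    by (elim allE[of _ "3::nat"] allE[of _ "8::real"]) auto
  have main: "\<bar>real (linked_count M N x) - singular_series_A * (y / ln y ^ 3)\<bar>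
         \<le> \<delta> y * (singular_series_A + 1) * (y / ln y ^ 3) + 5"
    if sm: "smooth_pair M N" and pos: "M > 0" "N > 0" and y: "y = x / real (2 * M * N)" "1 < y"
      and D: "real (2 * M * N) \<le> ln y ^ 8" for M N x y
  proof -
    have cop: "coprime M N" using sm by (simp add: smooth_pair_def)
    then obtain q0 r0 where qr0: "N * q0 = M * r0 + 1" "q0 \<le> M"
      using ex_coprime_solution pos by metis
    let ?a = "form_coeff M N" and ?b = "form_const M q0 r0"
    have le: "M \<le> 2 * M * N" "N \<le> 2 * M * N" using pos by auto
    then have "q0 \<le> 2 * M * N" using qr0(2) by linarith
    \<comment> \<open>The constant equals \<open>2 * N * q0 - 1\<close> with
      \<open>q0 \<le> M\<close>. Thus one bound on \<open>2 * M * N\<close> settles the size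
      condition for all coefficients.\<close>
    have p0: "2 * M * r0 + 1 \<le> 2 * M * N"
    proof -
      have "2 * (N * q0) \<le> 2 * (N * M)" using qr0 by (intro mult_le_mono) auto
      then show ?thesis using qr0 by (simp add: algebra_simps)
    qed
    moreover have "r0 \<le> 2 * M * r0" using pos by simp
    ultimately have "r0 \<le> 2 * M * N" by linarith
    then have bd: "\<bar>?a i\<bar> \<le> int (2 * M * N)" "\<bar>?b i\<bar> \<le> int (2 * M * N)" for i
      unfolding form_coeff_def form_const_def abs_of_nat of_nat_le_iff using le p0 \<open>q0 \<le> 2 * M * N\<close>
      by auto
    have "ln y > 0" using y by simp
    then have pw: "ln y powr 8 = ln y ^ 8" by simp
    have c1: "\<forall>i\<in>{1..3}. coprime (?a i) (?b i) \<and> 0 < ?a i"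
      using coprime_forms[OF qr0(1)] pos by (auto simp: form_coeff_def)
    have c2: "\<forall>i\<in>{1..3}. real_of_int \<bar>?a i\<bar> \<le> ln y powr 8 \<and> real_of_int \<bar>?b i\<bar> \<le> ln y powr 8"
    proof -
      have "real_of_int z \<le> ln y powr 8" if "z \<le> int (2 * M * N)" for z
        using that D unfolding pw by (metis of_int_le_iff of_int_of_nat_eq order_trans)
      then show ?thesis using bd by blast
    qed
    define w where "w = y / ln y ^ 3"
    have w: "w \<ge> 0" unfolding w_def using y(2) \<open>ln y > 0\<close> by simp
    from hl[OF c1 convergent_prod_forms[OF sm qr0(1)] y(2) c2]
    obtain e1 e2 where e: "\<bar>e1\<bar> \<le> \<delta> y" "\<bar>e2\<bar> \<le> \<delta> y"
      and pt: "real (prime_tuple_count 3 ?a ?b y) = (1 + e1) * singular_series_A * w + e2 * w"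
      unfolding singular_series_forms[OF sm qr0(1)] w_def by blast
    have "real (prime_tuple_count 3 ?a ?b y) - singular_series_A * w = (e1 * singular_series_A + e2) * w"
      unfolding pt by (simp add: algebra_simps)
    also have "\<bar>\<dots>\<bar> \<le> \<delta> y * (singular_series_A + 1) * w"
    proof -
      \<comment> \<open>Only \<open>e1\<close> carries the singular series, whence the factor
        \<open>singular_series_A + 1\<close>.\<close>
      have "\<bar>e1 * singular_series_A + e2\<bar> \<le> \<bar>e1\<bar> * singular_series_A + \<bar>e2\<bar>"
        using singular_series_A_pos abs_triangle_ineq[of "e1 * singular_series_A" e2]
        by (simp add: abs_mult)
      also have "\<dots> \<le> \<delta> y * singular_series_A + \<delta> y"
        using e singular_series_A_pos by (intro add_mono mult_right_mono) auto
      finally have "\<bar>e1 * singular_series_A + e2\<bar> \<le> \<delta> y * (singular_series_A + 1)"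
        by (simp add: algebra_simps)
      then show ?thesis using w by (simp add: abs_mult mult_right_mono)
    qed
    finally have "\<bar>real (prime_tuple_count 3 ?a ?b y) - singular_series_A * w\<bar>
        \<le> \<delta> y * (singular_series_A + 1) * w" .
    moreover have "real (linked_count M N x) \<le> real (prime_tuple_count 3 ?a ?b y) + 1"
      using linked_count_le_prime_tuple_count[OF cop pos qr0, of x] y by simp
    moreover have "real (prime_tuple_count 3 ?a ?b y) \<le> real (linked_count M N x) + 5"
      using prime_tuple_count_le_linked_count[OF cop pos qr0, of x] y by simp
    ultimately show ?thesis unfolding w_def by linarith
  qed
  show ?thesis by (rule that[OF \<delta>]) (rule main[OF _ _ _ refl])
qed

text \<open>For a fixed pair the size condition holds eventually and \<open>ln (x / D)\<close> is
  asymptotic to \<open>ln x\<close>; the additive error 5 vanishes after normalisation.\<close>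

lemma linked_count_asymp:
  assumes ghl: generalized_hardy_littlewood and sm: "smooth_pair M N" and pos: "M > 0" "N > 0"
  shows "((\<lambda>x. real (linked_count M N x) * (ln x ^ 3 / x)) \<longlongrightarrow> singular_series_A / real (2 * M * N)) at_top"
proof -
  obtain \<delta> :: "real \<Rightarrow> real"
    where \<delta>: "(\<delta> \<longlongrightarrow> 0) at_top"
    and bd: "\<And>x. 1 < x / real (2 * M * N) \<Longrightarrow> real (2 * M * N) \<le> ln (x / real (2 * M * N)) ^ 8 \<Longrightarrow>
       \<bar>real (linked_count M N x) - singular_series_A *
           ((x / real (2 * M * N)) / ln (x / real (2 * M * N)) ^ 3)\<bar>
         \<le> \<delta> (x / real (2 * M * N)) * (singular_series_A + 1) *
             ((x / real (2 * M * N)) / ln (x / real (2 * M * N)) ^ 3) + 5"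
    by (rule generalized_hardy_littlewood_linked_count[OF ghl]) (rule that, assumption, use sm pos in blast)
  define D where "D = real (2 * M * N)"
  have D: "D > 0" unfolding D_def using pos by simp
  let ?S = singular_series_A
  have ratio: "((\<lambda>x. (ln x / ln (x / D)) ^ 3) \<longlongrightarrow> 1) at_top" using D by real_asymp
  have xD: "filterlim (\<lambda>x. x / D) at_top at_top" using D by real_asymp
  have "((\<lambda>x. real (linked_count M N x) * (ln x ^ 3 / x) - ?S / D * (ln x / ln (x / D)) ^ 3) \<longlongrightarrow> 0) at_top"
  proof (rule Lim_null_comparison)
    have "eventually (\<lambda>x. 1 < x / D \<and> D \<le> ln (x / D) ^ 8 \<and> 1 < x) at_top"
      using D by (intro eventually_conj) real_asymp+
    then show "eventually (\<lambda>x. norm (real (linked_count M N x) * (ln x ^ 3 / x) - ?S / D * (ln x / ln (x / D)) ^ 3)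
       \<le> \<delta> (x / D) * (?S + 1) / D * (ln x / ln (x / D)) ^ 3 + 5 * (ln x ^ 3 / x)) at_top"
    proof eventually_elim
      case (elim x)
      define c where "c = ln x ^ 3 / x"
      have c: "c \<ge> 0" using elim by (simp add: c_def)
      have wc: "(x / D) / ln (x / D) ^ 3 * c = (ln x / ln (x / D)) ^ 3 / D"
        unfolding c_def power_divide using elim by simp
      have "\<bar>real (linked_count M N x) - ?S * ((x / D) / ln (x / D) ^ 3)\<bar> * c
         \<le> (\<delta> (x / D) * (?S + 1) * ((x / D) / ln (x / D) ^ 3) + 5) * c"
        using bd[of x] elim c unfolding D_def by (intro mult_right_mono) auto
      also have "\<dots> = \<delta> (x / D) * (?S + 1) * ((x / D) / ln (x / D) ^ 3 * c) + 5 * c"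
        by (simp add: algebra_simps)
      also have "\<dots> = \<delta> (x / D) * (?S + 1) / D * (ln x / ln (x / D)) ^ 3 + 5 * c"
        unfolding wc by simp
      also have "\<bar>real (linked_count M N x) - ?S * ((x / D) / ln (x / D) ^ 3)\<bar> * c
         = \<bar>(real (linked_count M N x) - ?S * ((x / D) / ln (x / D) ^ 3)) * c\<bar>"
        using c by (simp add: abs_mult)
      also have "(real (linked_count M N x) - ?S * ((x / D) / ln (x / D) ^ 3)) * c
         = real (linked_count M N x) * c - ?S * ((x / D) / ln (x / D) ^ 3 * c)"
        by (simp add: algebra_simps)
      also have "\<dots> = real (linked_count M N x) * c - ?S / D * (ln x / ln (x / D)) ^ 3"
        unfolding wc by simp
      finally show ?case by (simp add: c_def)
    qed
    have "((\<lambda>x. \<delta> (x / D) * (?S + 1) / D * (ln x / ln (x / D)) ^ 3 + 5 * (ln x ^ 3 / x)) \<longlongrightarrow>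
        0 * (?S + 1) / D * 1 + 5 * 0) at_top"
      using D by (intro tendsto_intros ratio filterlim_compose[OF \<delta> xD]) (real_asymp | simp)+
    then show "((\<lambda>x. \<delta> (x / D) * (?S + 1) / D * (ln x / ln (x / D)) ^ 3 + 5 * (ln x ^ 3 / x)) \<longlongrightarrow> 0) at_top"
      by simp
  qed
  from tendsto_add[OF this tendsto_mult[OF tendsto_const[of "?S / D"] ratio]]
  show ?thesis by (simp add: D_def)
qed

text \<open>The threshold for \<open>x\<close> precedes the choice of \<open>M\<close> and
  \<open>N\<close>, as domination over the whole family requires. The exponent \<open>-1/4\<close>
  comes from \<open>ln x ^ 3 / x \<le> x powr (-1/2)\<close> and
  \<open>D \<le> x ^ 2\<close>.\<close>

lemma linked_count_dominated:
  assumes ghl: generalized_hardy_littlewood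
  obtains B where "eventually (\<lambda>x. \<forall>M N. smooth_pair M N \<longrightarrow> M > 0 \<longrightarrow> N > 0 \<longrightarrow>
    real (linked_count M N x) * (ln x ^ 3 / x) \<le> B * real (2 * M * N) powr (-1/4)) at_top"
proof -
  let ?S = singular_series_A
  note S = singular_series_A_pos
  obtain \<delta> :: "real \<Rightarrow> real"
    where \<delta>: "(\<delta> \<longlongrightarrow> 0) at_top"
    and bd: "\<And>M N x. smooth_pair M N \<Longrightarrow> M > 0 \<Longrightarrow> N > 0 \<Longrightarrow> 1 < x / real (2 * M * N) \<Longrightarrow>
       real (2 * M * N) \<le> ln (x / real (2 * M * N)) ^ 8 \<Longrightarrow>
       \<bar>real (linked_count M N x) - ?S * ((x / real (2 * M * N)) / ln (x / real (2 * M * N)) ^ 3)\<bar>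
         \<le> \<delta> (x / real (2 * M * N)) * (?S + 1) *
             ((x / real (2 * M * N)) / ln (x / real (2 * M * N)) ^ 3) + 5"
    by (rule generalized_hardy_littlewood_linked_count[OF ghl]) (rule that)
  have "eventually (\<lambda>y. \<bar>\<delta> y\<bar> < 1) at_top"
    using tendstoD[OF \<delta>, of 1] by (simp add: dist_real_def)
  then obtain y1 where y1: "\<And>y. y \<ge> y1 \<Longrightarrow> \<bar>\<delta> y\<bar> < 1" by (auto simp: eventually_at_top_linorder)
  \<comment> \<open>This is the sum of the constants \<open>16 * ?S + 13\<close> and 9 from the two
    ranges of \<open>D\<close>.\<close>
  define B where "B = 16 * ?S + 22"
  \<comment> \<open>The bound by \<open>x powr (1/2)\<close> ensures
    \<open>x / D \<ge> x powr (1/2)\<close> for small \<open>D\<close>, and the last condition then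
    puts \<open>x / D\<close> where \<open>\<delta>\<close> is below 1.\<close>
  have "eventually (\<lambda>x::real. 1 < x \<and> (ln x / 2) ^ 8 \<le> x powr (1/2) \<and> ln x ^ 3 / x \<le> x powr (-1/2)
     \<and> y1 \<le> x powr (1/2)) at_top"
    by (intro eventually_conj) real_asymp+
  then have "eventually (\<lambda>x. \<forall>M N. smooth_pair M N \<longrightarrow> M > 0 \<longrightarrow> N > 0 \<longrightarrow>
    real (linked_count M N x) * (ln x ^ 3 / x) \<le> B * real (2 * M * N) powr (-1/4)) at_top"
  proof (eventually_elim, intro allI impI)
    fix x :: real and M N :: nat
    assume x: "1 < x \<and> (ln x / 2) ^ 8 \<le> x powr (1/2) \<and> ln x ^ 3 / x \<le> x powr (-1/2) \<and> y1 \<le> x powr (1/2)"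
    assume sm: "smooth_pair M N" and pos: "M > 0" "N > 0"
    define D where "D = real (2 * M * N)"
    have "1 \<le> 2 * M * N" using pos by simp
    then have D1: "D \<ge> 1" unfolding D_def by (metis of_nat_1 of_nat_mono)
    define c where "c = ln x ^ 3 / x"
    have L: "ln x > 0" using x by simp
    have c: "c \<ge> 0" using x by (simp add: c_def)
    have "real (linked_count M N x) * c \<le> B * D powr (-1/4)"
    proof (cases "linked_count M N x = 0")
      case True
      then show ?thesis using S by (simp add: B_def)
    next
      case False
      then have "D \<le> x ^ 2" using linked_count_pos[of M N x] by (simp add: D_def)
      then have "(x ^ 2) powr (-1/4) \<le> D powr (-1/4)" using D1 by (intro powr_mono2') auto
      moreover have "(x ^ 2) powr (-1/4) = x powr (-1/2)"
        using x by (simp add: powr_powr flip: powr_numeral)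
      ultimately have cD: "c \<le> D powr (-1/4)" using x unfolding c_def by linarith
      show ?thesis
      proof (cases "D \<le> (ln x / 2) ^ 8")
        case True
        define y where "y = x / D"
        have "D \<le> x powr (1/2)" using True x by linarith
        then have "x / x powr (1/2) \<le> y" unfolding y_def using x D1 by (intro divide_left_mono) auto
        moreover have "x / x powr (1/2) = x powr (1/2)" using x by (simp add: powr_half_sqrt real_div_sqrt)
        ultimately have y: "x powr (1/2) \<le> y" by simp
        moreover have "x powr (1/2) > 1" using x by simp
        ultimately have y': "y > 1" by linarith
        have "ln (x powr (1/2)) \<le> ln y" using y x y' by (subst ln_le_cancel_iff) auto
        \<comment> \<open>This halving of the logarithm is the reason for the threshold
          \<open>(ln x / 2) ^ 8\<close>: it implies the size condition at \<open>y\<close>.\<close>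
        then have lny: "ln x / 2 \<le> ln y" using x by (simp add: ln_powr)
        then have "(ln x / 2) ^ 8 \<le> ln y ^ 8" using L by (intro power_mono) auto
        then have Dy: "D \<le> ln y ^ 8" using True by linarith
        define w where "w = y / ln y ^ 3"
        have w0: "w \<ge> 0" unfolding w_def using y' by simp
        have dl: "\<delta> y \<le> 1" using y1[of y] y x by linarith
        have "\<bar>real (linked_count M N x) - ?S * w\<bar> \<le> \<delta> y * (?S + 1) * w + 5"
          using bd[OF sm pos, of x] y' Dy unfolding w_def y_def D_def by blast
        also have "\<dots> \<le> 1 * (?S + 1) * w + 5"
          using dl w0 S by (intro add_mono mult_right_mono) auto
        finally have "real (linked_count M N x) \<le> (2 * ?S + 1) * w + 5"
          by (simp add: algebra_simps)
        then have "real (linked_count M N x) * c \<le> ((2 * ?S + 1) * w + 5) * c"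
          using c by (rule mult_right_mono)
        also have "\<dots> = (2 * ?S + 1) * (w * c) + 5 * c" by (simp add: algebra_simps)
        also have "w * c \<le> 8 * D powr (-1/4)"
        proof -
          have "ln x ^ 3 \<le> (2 * ln y) ^ 3" using lny L by (intro power_mono) auto
          then have "ln x ^ 3 / ln y ^ 3 \<le> 8" using y' by (simp add: power_mult_distrib field_simps)
          have "w * c = ln x ^ 3 / ln y ^ 3 * (1 / D)"
            unfolding w_def c_def y_def using x by simp
          also have "\<dots> \<le> 8 * (1 / D)"
            using D1 \<open>ln x ^ 3 / ln y ^ 3 \<le> 8\<close> by (intro mult_right_mono) auto
          also have "1 / D = D powr (-1)" using D1 by (simp add: powr_minus_divide)
          also have "\<dots> \<le> D powr (-1/4)" using D1 by (intro powr_mono) auto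
          finally show ?thesis by simp
        qed
        then have "(2 * ?S + 1) * (w * c) + 5 * c \<le> (2 * ?S + 1) * (8 * D powr (-1/4)) + 5 * D powr (-1/4)"
          using cD S by (intro add_mono mult_left_mono) auto
        also have "\<dots> \<le> B * D powr (-1/4)" unfolding B_def by (simp add: algebra_simps)
        finally show ?thesis .
      next
        case False
        have "real (linked_count M N x) \<le> x / D + 1"
          using linked_count_trivial[of M N x] sm pos x by (simp add: smooth_pair_def D_def)
        then have "real (linked_count M N x) * c \<le> (x / D + 1) * c" using c by (rule mult_right_mono)
        also have "\<dots> = ln x ^ 3 * (1 / D) + c" unfolding c_def using x by (simp add: add_divide_distrib distrib_right)
        also have "ln x ^ 3 * (1 / D) \<le> 8 * D powr (-1/4)"
        proof -
          \<comment> \<open>The power 3/8 converts the lower bound on \<open>D\<close> into a bound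
            for \<open>ln x ^ 3\<close>, at the cost of \<open>2 ^ 3 = 8\<close>.\<close>
          have "((ln x / 2) ^ 8) powr (3/8) \<le> D powr (3/8)" using False L by (intro powr_mono2) auto
          moreover have "((ln x / 2) ^ 8) powr (3/8) = (ln x / 2) ^ 3"
            using L by (simp add: powr_powr flip: powr_numeral)
          ultimately have "ln x ^ 3 \<le> 8 * D powr (3/8)" by (simp add: power_divide)
          then have "ln x ^ 3 * (1 / D) \<le> 8 * D powr (3/8) * (1 / D)" using D1 by (intro mult_right_mono) auto
          also have "\<dots> = 8 * (D powr (3/8) * D powr (-1))" using D1 by (simp add: powr_minus_divide)
          also have "\<dots> = 8 * D powr (-5/8)"
            by (simp only: powr_add[symmetric]) simp
          also have "\<dots> \<le> 8 * D powr (-1/4)" using D1 by (intro mult_left_mono powr_mono) auto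
          finally show ?thesis .
        qed
        finally have "real (linked_count M N x) * c \<le> 9 * D powr (-1/4)" using cD by linarith
        also have "\<dots> \<le> B * D powr (-1/4)" unfolding B_def using S by (intro mult_right_mono) auto
        finally show ?thesis .
      qed
    qed
    then show "real (linked_count M N x) * (ln x ^ 3 / x) \<le> B * real (2 * M * N) powr (-1/4)"
      by (simp add: c_def D_def)
  qed
  then show ?thesis using that by blast
qed

subsection \<open>Summation over the classes\<close>

lemma smooth_pairI:
  assumes "coprime M N" "M * N = 2 ^ Suc k * 3 ^ Suc j"
  shows "smooth_pair M N" "M > 0" "N > 0"
proof -
  have "M * N > 0" unfolding assms(2) by simp
  then show "M > 0" "N > 0" by auto
  have "l dvd M * N \<longleftrightarrow> l = 2 \<or> l = 3" if "prime l" for l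
  proof
    assume "l dvd M * N"
    then have "l dvd 2 \<or> l dvd 3"
      unfolding assms(2) using that by (auto simp only: prime_dvd_mult_iff dest: prime_dvd_power)
    then show "l = 2 \<or> l = 3" using that by (auto dest: primes_dvd_imp_eq[rotated 2])
  next
    assume "l = 2 \<or> l = 3"
    then show "l dvd M * N" unfolding assms(2) by auto
  qed
  then show "smooth_pair M N" using assms by (simp add: smooth_pair_def)
qed

text \<open>Double series are written as integrals over the counting measure, so that dominated
  convergence applies to them.\<close>

lemma geometric_product_integral:
  fixes a b :: real
  assumes "0 < a" "a < 1" "0 < b" "b < 1"
  shows "integrable (count_space UNIV) (\<lambda>(k::nat, j::nat). a ^ k * b ^ j)"
    and "(\<integral>(k::nat, j::nat). a ^ k * b ^ j \<partial>count_space UNIV) = 1 / (1 - a) * (1 / (1 - b))"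
proof -
  have s: "Infinite_Set_Sum.abs_summable_on (\<lambda>k::nat. c ^ k) UNIV"
    "infsetsum (\<lambda>k::nat. c ^ k) UNIV = 1 / (1 - c)" if "0 < c" "c < 1" for c :: real
  proof -
    show s: "Infinite_Set_Sum.abs_summable_on (\<lambda>k::nat. c ^ k) UNIV"
      using that by (simp add: abs_summable_on_nat_iff' summable_geometric)
    show "infsetsum (\<lambda>k::nat. c ^ k) UNIV = 1 / (1 - c)"
      using infsetsum_nat[OF s] that by (simp add: suminf_geometric)
  qed
  note sa = s[OF assms(1,2)] and sb = s[OF assms(3,4)]
  show "integrable (count_space UNIV) (\<lambda>(k::nat, j::nat). a ^ k * b ^ j)"
    using abs_summable_on_product[OF countableI_type countableI_type sa(1) sb(1)]
    by (simp add: Infinite_Set_Sum.abs_summable_on_def)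
  show "(\<integral>(k::nat, j::nat). a ^ k * b ^ j \<partial>count_space UNIV) = 1 / (1 - a) * (1 / (1 - b))"
    using infsetsum_product[OF countableI_type countableI_type sa(1) sb(1)] sa(2) sb(2)
    by (simp add: infsetsum_def)
qed

text \<open>Both families have \<open>D = 12 * 2 ^ k * 3 ^ j\<close>, so one argument serves them;
  how the powers are split between \<open>M\<close> and \<open>N\<close> matters only for
  coprimality and disjointness.\<close>

lemma linked_family_asymp:
  fixes M N :: "nat \<times> nat \<Rightarrow> nat"
  assumes ghl: generalized_hardy_littlewood
    and cop: "\<And>k j. coprime (M (k, j)) (N (k, j))"
    and MN: "\<And>k j. M (k, j) * N (k, j) = 2 ^ Suc k * 3 ^ Suc j"
    and disj: "disjoint_family (\<lambda>i. linked_primes (M i) (N i))"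
  shows "((\<lambda>x. real (card {p \<in> (\<Union>i. linked_primes (M i) (N i)). real p \<le> x}) * (ln x ^ 3 / x))
           \<longlongrightarrow> singular_series_A / 4) at_top"
proof -
  let ?S = singular_series_A
  note sm = smooth_pairI[OF cop MN]
  define g where "g x i = real (linked_count (M i) (N i) x) * (ln x ^ 3 / x)" for x i
  have D: "real (2 * M (k, j) * N (k, j)) = 12 * 2 ^ k * 3 ^ j" for k j
    using MN[of k j] by (simp add: mult.assoc)
  obtain B where B: "eventually (\<lambda>x. \<forall>M N. smooth_pair M N \<longrightarrow> M > 0 \<longrightarrow> N > 0 \<longrightarrow>
    real (linked_count M N x) * (ln x ^ 3 / x) \<le> B * real (2 * M * N) powr (-1/4)) at_top"
    using linked_count_dominated[OF ghl] by blast
  define a b :: real where "a = 2 powr (-1/4)" and "b = 3 powr (-1/4)"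
  have ab: "0 < a" "a < 1" "0 < b" "b < 1"
    unfolding a_def b_def using powr_less_mono[of "-1/4" 0 "2::real"] powr_less_mono[of "-1/4" 0 "3::real"] by auto
  \<comment> \<open>The dominating function factors into two geometric series with ratios
    \<open>a\<close> and \<open>b\<close>.\<close>
  have Dp: "real (2 * M (k, j) * N (k, j)) powr (-1/4) = 12 powr (-1/4) * (a ^ k * b ^ j)" for k j
    unfolding D a_def b_def
    by (simp add: powr_mult powr_powr mult.commute flip: powr_realpow)
  define w where "w = (\<lambda>(k::nat, j::nat). B * 12 powr (-1/4) * (a ^ k * b ^ j))"
  define lim where "lim = (\<lambda>(k::nat, j::nat). ?S / 12 * ((1/2) ^ k * (1/3) ^ j))"
  have "((\<lambda>x. integral\<^sup>L (count_space UNIV) (g x)) \<longlongrightarrow> integral\<^sup>L (count_space UNIV) lim) at_top"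
  proof (rule integral_dominated_convergence_at_top)
    have "integrable (count_space UNIV)
        (\<lambda>i. B * 12 powr (-1/4) * (case i of (k::nat, j::nat) \<Rightarrow> a ^ k * b ^ j))"
      by (intro integrable_mult_right geometric_product_integral ab)
    then show "integrable (count_space UNIV) w"
      unfolding w_def by (simp add: case_prod_unfold)
    show "eventually (\<lambda>x. AE i in count_space UNIV. norm (g x i) \<le> w i) at_top"
      using B eventually_gt_at_top[of 1]
    proof eventually_elim
      case (elim x)
      have "norm (g x (k, j)) \<le> w (k, j)" for k j
      proof -
        have "g x (k, j) \<ge> 0" using elim by (simp add: g_def)
        moreover have "g x (k, j) \<le> B * real (2 * M (k, j) * N (k, j)) powr (-1/4)"
          unfolding g_def using elim sm[of k j] by blast
        ultimately show ?thesis by (simp only: Dp w_def) simp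
      qed
      then show ?case by auto
    qed
    have "((\<lambda>x. g x (k, j)) \<longlongrightarrow> lim (k, j)) at_top" for k j
    proof -
      have "((\<lambda>x. g x (k, j)) \<longlongrightarrow> ?S / real (2 * M (k, j) * N (k, j))) at_top"
        unfolding g_def using linked_count_asymp[OF ghl sm[of k j]] by simp
      then show ?thesis unfolding D lim_def by (simp add: field_simps)
    qed
    then show "AE i in count_space UNIV. ((\<lambda>x. g x i) \<longlongrightarrow> lim i) at_top" by auto
  qed auto
  also have "integral\<^sup>L (count_space UNIV) lim = ?S / 4"
  proof -
    have "integral\<^sup>L (count_space UNIV) lim
       = ?S / 12 * (\<integral>(k::nat, j::nat). (1/2) ^ k * (1/3) ^ j \<partial>count_space UNIV)"
      unfolding lim_def case_prod_unfold by (rule integral_mult_right_zero)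
    also have "(\<integral>(k::nat, j::nat). (1/2) ^ k * (1/3::real) ^ j \<partial>count_space UNIV) = 3"
      by (subst geometric_product_integral) auto
    finally show ?thesis by simp
  qed
  also have "(\<lambda>x. integral\<^sup>L (count_space UNIV) (g x)) =
     (\<lambda>x. real (card {p \<in> (\<Union>i. linked_primes (M i) (N i)). real p \<le> x}) * (ln x ^ 3 / x))"
  proof
    fix x :: real
    define F where "F i = {p \<in> linked_primes (M i) (N i). real p \<le> x}" for i
    define I where "I = {i. F i \<noteq> {}}"
    have finF: "finite (F i)" for i
      unfolding F_def by (rule finite_nat_le_real)
    have Fc: "card (F i) = linked_count (M i) (N i) x" for i
      by (simp add: F_def linked_count_def)
    \<comment> \<open>A nonempty class has \<open>D \<le> x ^ 2\<close>, which bounds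
      \<open>k\<close> and \<open>j\<close>; the integral is therefore a finite sum of
      cardinalities.\<close>
    have finI: "finite I"
    proof (rule finite_subset)
      show "I \<subseteq> {..nat \<lfloor>x ^ 2\<rfloor>} \<times> {..nat \<lfloor>x ^ 2\<rfloor>}"
      proof
        fix i assume i: "i \<in> I"
        obtain k j where kj: "i = (k, j)" by (cases i)
        have "linked_count (M i) (N i) x > 0"
          using i finF[of i] Fc[of i] unfolding I_def by (simp add: card_gt_0_iff flip: Fc)
        then have le: "12 * 2 ^ k * 3 ^ j \<le> x ^ 2" using linked_count_pos D[of k j] kj by metis
        have "real k \<le> 2 ^ k" "real j \<le> 3 ^ j"
          using less_exp[of k] of_nat_less_two_power[of j, where ?'a = real] power_mono[of 2 "3::real" j]
          by (auto intro: less_imp_le order_trans[of _ "2 ^ j"])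
        moreover have "2 ^ k * 1 \<le> 2 ^ k * (3::real) ^ j" "1 * 3 ^ j \<le> 2 ^ k * (3::real) ^ j"
          by (intro mult_mono; simp)+
        ultimately have "real k \<le> x ^ 2" "real j \<le> x ^ 2" using le by linarith+
        then show "i \<in> {..nat \<lfloor>x ^ 2\<rfloor>} \<times> {..nat \<lfloor>x ^ 2\<rfloor>}" unfolding kj by (simp add: le_nat_floor)
      qed
    qed simp
    have U: "{p \<in> (\<Union>i. linked_primes (M i) (N i)). real p \<le> x} = (\<Union>i\<in>I. F i)"
      unfolding I_def F_def by blast
    have dF: "\<forall>i\<in>I. \<forall>j\<in>I. i \<noteq> j \<longrightarrow> F i \<inter> F j = {}"
      using disj unfolding disjoint_family_on_def F_def by blast
    have z: "g x i = 0" if "i \<notin> I" for i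
      using that Fc[of i] by (simp add: g_def I_def)
    have "integral\<^sup>L (count_space UNIV) (g x) = (\<Sum>i | i \<in> UNIV \<and> g x i \<noteq> 0. g x i)"
      by (rule lebesgue_integral_count_space_finite_support)
         (rule finite_subset[OF _ finI], use z in blast)
    also have "\<dots> = (\<Sum>i\<in>I. g x i)"
      using z finI by (intro sum.mono_neutral_left) auto
    also have "\<dots> = real (\<Sum>i\<in>I. card (F i)) * (ln x ^ 3 / x)"
      by (simp only: g_def Fc of_nat_sum sum_distrib_right)
    also have "(\<Sum>i\<in>I. card (F i)) = card (\<Union>i\<in>I. F i)"
      using finI finF dF by (subst card_UN_disjoint) auto
    finally show "integral\<^sup>L (count_space UNIV) (g x) =
        real (card {p \<in> (\<Union>i. linked_primes (M i) (N i)). real p \<le> x}) * (ln x ^ 3 / x)"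
      unfolding U .
  qed
  finally show ?thesis .
qed

section \<open>Decomposition of \<open>setA\<close> into disjoint classes\<close>

lemma power_times_exponent_unique:
  fixes b :: nat
  assumes "b ^ m * u = b ^ n * v" "b > 0" "\<not> b dvd u" "\<not> b dvd v"
  shows "m = n"
  using assms(1)
\<comment> \<open>Both exponents drop together until one is 0; a positive one left over would make
  \<open>b\<close> divide \<open>u\<close> or \<open>v\<close>.\<close>
proof (induction m n rule: diff_induct)
  case (1 x)
  then show ?case using assms by (cases x) auto
next
  case (2 y)
  then show ?case using assms by auto
next
  case (3 x y)
  then have "b * (b ^ x * u) = b * (b ^ y * v)" by (simp add: mult.assoc)
  then show ?case using 3(1) assms(2) by simp
qed

lemma setA_eq:
  "setA = (\<Union>(k, j). linked_primes 1 (2 ^ Suc k * 3 ^ Suc j)) \<union>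
          (\<Union>(k, j). linked_primes (2 ^ Suc k) (3 ^ Suc j))"  (is "_ = ?U1 \<union> ?U2")
proof (intro equalityI subsetI)
  fix p assume "p \<in> setA"
  then have p: "prime p" and ex: "\<exists>\<alpha> \<beta> \<gamma> q r. 1 \<le> \<alpha> \<and> 1 \<le> \<beta> \<and> 1 \<le> \<gamma> \<and>
        prime q \<and> prime r \<and> gcd 6 (q * r) = 1 \<and>
        p + 1 = 2 ^ \<alpha> * 3 ^ \<beta> * q \<and> p - 1 = 2 ^ \<gamma> * r"
    unfolding setA_def mem_Collect_eq by simp_all
  from ex obtain \<alpha> \<beta> \<gamma> q r where ge: "1 \<le> \<alpha>" "1 \<le> \<beta>" "1 \<le> \<gamma>"
    and qr: "prime q" "prime r" "gcd 6 (q * r) = 1" "p + 1 = 2 ^ \<alpha> * 3 ^ \<beta> * q" "p - 1 = 2 ^ \<gamma> * r"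
    by (elim exE conjE) (rule that)
  obtain a b c where abc: "\<alpha> = Suc a" "\<beta> = Suc b" "\<gamma> = Suc c"
    using ge by (auto simp: Suc_le_eq gr0_conv_Suc)
  have c6: "coprime 6 (q * r)" using qr(3) by (simp only: coprime_iff_gcd_eq_1)
  have p1: "p = 2 * 2 ^ c * r + 1" using qr(5) prime_gt_1_nat[OF p] by (simp add: abc)
  have p2: "p + 1 = 2 * (2 ^ a * 3 ^ Suc b) * q" using qr(4) by (simp add: abc)
  have e: "2 ^ a * 3 ^ Suc b * q = 2 ^ c * r + 1" using p1 p2 by simp
  have "odd (q * r)" using c6 coprime_common_divisor[of 6 "q * r" 2] by auto
  then have odd: "odd q" "odd r" by auto
  \<comment> \<open>The sides \<open>N * q\<close> and \<open>M * r\<close> of \<open>e\<close>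
    differ by 1, so exactly one of them is even; as \<open>q\<close> and \<open>r\<close> are odd,
    exactly one of \<open>a\<close> and \<open>c\<close> is positive.\<close>
  consider "a = 0" "c > 0" | "a > 0" "c = 0"
  proof -
    have "even (2 ^ a * 3 ^ Suc b * q) \<longleftrightarrow> a > 0" "even (2 ^ c * r) \<longleftrightarrow> c > 0" using odd by auto
    then have "a > 0 \<longleftrightarrow> c = 0" using e by (metis even_plus_one_iff neq0_conv)
    then show ?thesis using that by blast
  qed
  then show "p \<in> ?U1 \<union> ?U2"
  proof cases
    case 1
    then obtain k where k: "c = Suc k" by (cases c) auto
    have "p \<in> linked_primes (2 ^ Suc k) (3 ^ Suc b)"
      using p qr c6 p1 p2 1 k unfolding linked_primes_def by auto
    then show ?thesis by blast
  next
    case 2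
    then obtain k where k: "a = Suc k" by (cases a) auto
    have "p \<in> linked_primes 1 (2 ^ Suc k * 3 ^ Suc b)"
      using p qr c6 p1 p2 2 k unfolding linked_primes_def by auto
    then show ?thesis by blast
  qed
next
  fix p assume "p \<in> ?U1 \<union> ?U2"
  then obtain k j M N where MN: "M = 1 \<and> N = 2 ^ Suc k * 3 ^ Suc j \<or> M = 2 ^ Suc k \<and> N = 3 ^ Suc j"
    and "p \<in> linked_primes M N" by blast
  then obtain q r where p: "prime p" "prime q" "prime r" "coprime 6 (q * r)"
    "p + 1 = 2 * N * q" "p = 2 * M * r + 1"
    unfolding linked_primes_def by blast
  have "3 dvd N" using MN by auto
  then have "3 dvd p + 1" unfolding p(5) by simp
  then have "[p = 2] (mod 3)" unfolding cong_def by presburger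
  have c6: "gcd 6 (q * r) = 1" using p(4) by (simp only: coprime_iff_gcd_eq_1)
  have "\<exists>\<alpha> \<beta> \<gamma> q r. 1 \<le> \<alpha> \<and> 1 \<le> \<beta> \<and> 1 \<le> \<gamma> \<and>
        prime q \<and> prime r \<and> gcd 6 (q * r) = 1 \<and>
        p + 1 = 2 ^ \<alpha> * 3 ^ \<beta> * q \<and> p - 1 = 2 ^ \<gamma> * r"
    using MN
  proof
    assume "M = 1 \<and> N = 2 ^ Suc k * 3 ^ Suc j"
    then have "p + 1 = 2 ^ Suc (Suc k) * 3 ^ Suc j * q" "p - 1 = 2 ^ 1 * r" using p by auto
    with p c6 show ?thesis
      by (intro exI[of _ "Suc (Suc k)"] exI[of _ "Suc j"] exI[of _ 1] exI[of _ q] exI[of _ r]) simp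
  next
    assume "M = 2 ^ Suc k \<and> N = 3 ^ Suc j"
    then have "p + 1 = 2 ^ 1 * 3 ^ Suc j * q" "p - 1 = 2 ^ Suc (Suc k) * r" using p by auto
    with p c6 show ?thesis
      by (intro exI[of _ 1] exI[of _ "Suc j"] exI[of _ "Suc (Suc k)"] exI[of _ q] exI[of _ r]) simp
  qed
  with p(1) \<open>[p = 2] (mod 3)\<close> show "p \<in> setA"
    by (simp only: setA_def mem_Collect_eq simp_thms)
qed

text \<open>The exponents are valuations of \<open>p\<close>: \<open>m + 1\<close> and
  \<open>a + 1\<close> are the exponents of 2 in \<open>p - 1\<close> and \<open>p + 1\<close>, and
  \<open>b\<close> is that of 3 in \<open>p + 1\<close>. Setting \<open>m = 0\<close> or
  \<open>a = 0\<close> gives the two families.\<close>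

lemma linked_primes_unique:
  assumes p: "p \<in> linked_primes (2 ^ m) (2 ^ a * 3 ^ b)" "p \<in> linked_primes (2 ^ n) (2 ^ a' * 3 ^ b')"
  shows "m = n" "a = a'" "b = b'"
proof -
  obtain q r where 1: "coprime 6 (q * r)" "p + 1 = 2 * (2 ^ a * 3 ^ b) * q" "p = 2 * 2 ^ m * r + 1"
    using p(1) unfolding linked_primes_def by blast
  obtain q' r' where 2: "coprime 6 (q' * r')" "p + 1 = 2 * (2 ^ a' * 3 ^ b') * q'" "p = 2 * 2 ^ n * r' + 1"
    using p(2) unfolding linked_primes_def by blast
  have nd: "\<not> 2 dvd q" "\<not> 2 dvd r" "\<not> 3 dvd q" if "coprime 6 (q * r)" for q r :: nat
  proof -
    have "coprime (2 * 3) q" "coprime (2 * 3) r" using that by auto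
    then have "coprime 2 q" "coprime 3 q" "coprime 2 r" by (simp_all only: coprime_mult_left_iff)
    then show "\<not> 2 dvd q" "\<not> 2 dvd r" "\<not> 3 dvd q" by (auto simp: coprime_absorb_left)
  qed
  show "m = n"
    using power_times_exponent_unique[of 2 m r n r'] nd[OF 1(1)] nd[OF 2(1)] 1(3) 2(3) by simp
  have e: "2 ^ a * 3 ^ b * q = 2 ^ a' * 3 ^ b' * q'" using 1(2) 2(2) by simp
  show "a = a'"
    using power_times_exponent_unique[of 2 a "3 ^ b * q" a' "3 ^ b' * q'"] nd[OF 1(1)] nd[OF 2(1)] e
    by (simp add: mult.assoc)
  then show "b = b'"
    using power_times_exponent_unique[of 3 b q b' q'] nd[OF 1(1)] nd[OF 2(1)] e
    by (simp add: mult.assoc)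
qed

theorem theorem4p5:
  assumes "generalized_hardy_littlewood"
  shows "(\<lambda>x::real. real (card {p \<in> setA. real p \<le> x}))
           \<sim>[at_top] (\<lambda>x. singular_series_A / 2 * (x / ln x ^ 3))"
proof -
  let ?M1 = "\<lambda>_::nat \<times> nat. 1::nat" and ?N1 = "\<lambda>(k, j). 2 ^ Suc k * 3 ^ Suc j :: nat"
  let ?M2 = "\<lambda>(k, j::nat). 2 ^ Suc k :: nat" and ?N2 = "\<lambda>(k::nat, j). 3 ^ Suc j :: nat"
  let ?U1 = "\<Union>i. linked_primes (?M1 i) (?N1 i)" and ?U2 = "\<Union>i. linked_primes (?M2 i) (?N2 i)"
  have lim1: "((\<lambda>x. real (card {p \<in> ?U1. real p \<le> x}) * (ln x ^ 3 / x)) \<longlongrightarrow> singular_series_A / 4) at_top"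
  proof (rule linked_family_asymp[OF assms])
    show "disjoint_family (\<lambda>i. linked_primes (?M1 i) (?N1 i))"
      unfolding disjoint_family_on_def
      using linked_primes_unique(2,3)[of _ 0 "Suc _" "Suc _" 0 "Suc _" "Suc _"] by force
  qed auto
  have lim2: "((\<lambda>x. real (card {p \<in> ?U2. real p \<le> x}) * (ln x ^ 3 / x)) \<longlongrightarrow> singular_series_A / 4) at_top"
  proof (rule linked_family_asymp[OF assms])
    show "disjoint_family (\<lambda>i. linked_primes (?M2 i) (?N2 i))"
      unfolding disjoint_family_on_def
      using linked_primes_unique(1,3)[of _ "Suc _" 0 "Suc _" "Suc _" 0 "Suc _"] by force
    show "coprime (?M2 (k, j)) (?N2 (k, j))" for k j
      by (simp del: power_Suc)
  qed auto
  \<comment> \<open>The exponent of 2 in \<open>M\<close> is 0 in the first family and positive in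
    the second.\<close>
  have disj: "?U1 \<inter> ?U2 = {}"
    using linked_primes_unique(1)[of _ 0 "Suc _" "Suc _" "Suc _" 0 "Suc _"] by force
  have "card {p \<in> setA. real p \<le> x} = card {p \<in> ?U1. real p \<le> x} + card {p \<in> ?U2. real p \<le> x}" for x
  proof -
    have "setA = ?U1 \<union> ?U2" unfolding setA_eq by (simp only: case_prod_unfold)
    then have "{p \<in> setA. real p \<le> x} = {p \<in> ?U1. real p \<le> x} \<union> {p \<in> ?U2. real p \<le> x}"
      by blast
    moreover have "{p \<in> ?U1. real p \<le> x} \<inter> {p \<in> ?U2. real p \<le> x} = {}"
      using disj by blast
    ultimately show ?thesis by (simp only: card_Un_disjoint finite_nat_le_real)
  qed
  with tendsto_add[OF lim1 lim2]
  have lim: "((\<lambda>x. real (card {p \<in> setA. real p \<le> x}) * (ln x ^ 3 / x)) \<longlongrightarrow> singular_series_A / 2) at_top"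
    by (simp add: add_divide_distrib distrib_right)
  show ?thesis
  proof (rule asymp_equivI')
    \<comment> \<open>Positivity of \<open>singular_series_A\<close> allows division by the
      limit.\<close>
    have "((\<lambda>x. real (card {p \<in> setA. real p \<le> x}) * (ln x ^ 3 / x) / (singular_series_A / 2)) \<longlongrightarrow> 1) at_top"
      using tendsto_divide[OF lim tendsto_const[of "singular_series_A / 2"]] singular_series_A_pos by simp
    then show "((\<lambda>x. real (card {p \<in> setA. real p \<le> x}) / (singular_series_A / 2 * (x / ln x ^ 3))) \<longlongrightarrow> 1) at_top"
      by (simp add: field_simps)
  qed
qed

end
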